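(* Let $a,b,d>0$, let $c_-$ be the unique negative zero of $Q(x)=4ax^3-b^2x^2-18abd\,x+27a^2d^2+4db^3$, let $c^*=-\sqrt{3bd}$, and assume $c\in(c_-,c^* )$. Let $\phi(x)=\frac{ax^3+bx^2+cx+d}{x^3}$ ($x>0$) and $x_m=\frac{-c-\sqrt{c^2-3bd}}{b}$. Assume $\phi$ has two equilibria $\overline{t}_1<\overline{t}_2$, and let $\{t_n\}_{n\ge0}$ be a positive solution of $t_{n+1}=\phi(t_n)$. \begin{description} \item[(a)] Case $c=c_m$. Assume $\overline{t}_2\leq a$ and let $\delta<x_m$ be the unique number with $\phi(\delta)=\overline{t}_2$. Then: \begin{description} \item[(a1)] If $x_m\leq\overline{t}_1$: $\{t_n\}$ converges to $\overline{t}_1$ if $t_0\in(\delta,\overline{t}_2)$, and otherwise converges to $\overline{t}_2$. \item[(a2)] If $\overline{t}_1<x_m$: \begin{description} \item[(a21)] if $\phi$ has no 2-cycle, then $\{t_n\}$ converges to $\overline{t}_1$ if $t_0\in(\delta,\overline{t}_2)$, and otherwise converges to $\overline{t}_2$; \item[(a22)] if $\phi$ has one 2-cycle $(p,q)$ with $p<\overline{t}_1<q\leq x_m$, let $I=[\phi(x_m),\phi^2(x_m)]$ and $\mathcal{S}=\{t>0:\phi^n(t)=\overline{t}_1\text{ for some }n\geq0\}$. Then $\{t_n\}$ converges to the 2-cycle $(p,q)$ if $t_0\in(\delta,\overline{t}_2)\setminus\mathcal{S}$, converges to $\overline{t}_1$ if $t_0\in\mathcal{S}$, and otherwise converges to $\overline{t}_2$.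 In particular, if $t_0\in I\setminus\{\overline{t}_1\}$ then $\{t_n\}$ converges to the 2-cycle $(p,q)$. \end{description} \end{description} \item[(b)] Case $c=c_M$. Assume $\overline{t}_1\leq a$ and let $\delta'<x_m$ be the unique number with $\phi(\delta')=\overline{t}_1$. Then $\{t_n\}$ converges to $\overline{t}_1$ if $t_0\in[\delta',\overline{t}_1]$, and otherwise converges to $\overline{t}_2$. \end{description}
   Context: $x_m$ is the local minimum point of $\phi$. An equilibrium is $t>0$ with $\phi(t)=t$, equivalently a positive root of $P(t)=t^4-at^3-bt^2-ct-d$. Let $c_b$ be the unique negative root of $H(x)=108x^2+(108ab+27a^3)x-9a^2b^2-32b^3$. When $c_b<\frac{b^2-12d}{3a}$, as the parameter $c$ increases from $c_b$ (with $a,b,d$ fixed), $P$ first acquires a positive double root $t_m$ at a local minimum of $P$, and later a positive double root $t_M$ at a local maximum of $P$; $c_m$ and $c_M$ denote the corresponding values of $c$. For $c\in(c_-,c^* )$, $\phi$ has exactly two equilibria only when $c=c_m$ or $c=c_M$. A 2-cycle is a pair $(p,q)$ of positive numbers with $p\ne q$, $\phi(p)=q$, $\phi(q)=p$. A positive solution is a sequence with $t_0>0$ and $t_{n+1}=\phi(t_n)$. The sequence $\{t_n\}$ converges to the 2-cycle $(p,q)$ if one of the subsequences $\{t_{2n}\}$, $\{t_{2n+1}\}$ converges to $p$ and the other to $q$. *)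

theory Defs
  imports Complex_Main
begin

definition phi :: "real \<Rightarrow> real \<Rightarrow> real \<Rightarrow> real \<Rightarrow> real \<Rightarrow> real" where
  "phi a b c d x = (a * x^3 + b * x^2 + c * x + d) / x^3"

definition Ppoly :: "real \<Rightarrow> real \<Rightarrow> real \<Rightarrow> real \<Rightarrow> real \<Rightarrow> real" where
  "Ppoly a b c d t = t^4 - a * t^3 - b * t^2 - c * t - d"

definition Pderiv :: "real \<Rightarrow> real \<Rightarrow> real \<Rightarrow> real \<Rightarrow> real" where
  "Pderiv a b c t = 4 * t^3 - 3 * a * t^2 - 2 * b * t - c"

definition Qpoly :: "real \<Rightarrow> real \<Rightarrow> real \<Rightarrow> real \<Rightarrow> real" where
  "Qpoly a b d x = 4*a*x^3 - b^2*x^2 - 18*a*b*d*x + 27*a^2*d^2 + 4*d*b^3"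

definition Hpoly :: "real \<Rightarrow> real \<Rightarrow> real \<Rightarrow> real" where
  "Hpoly a b x = 108*x^2 + (108*a*b + 27*a^3)*x - 9*a^2*b^2 - 32*b^3"

definition c_minus :: "real \<Rightarrow> real \<Rightarrow> real \<Rightarrow> real" where
  "c_minus a b d = (THE x. x < 0 \<and> Qpoly a b d x = 0)"

definition c_star :: "real \<Rightarrow> real \<Rightarrow> real" where
  "c_star b d = - sqrt (3 * b * d)"

definition c_b :: "real \<Rightarrow> real \<Rightarrow> real" where
  "c_b a b = (THE x. x < 0 \<and> Hpoly a b x = 0)"

definition x_m :: "real \<Rightarrow> real \<Rightarrow> real \<Rightarrow> real" where
  "x_m b c d = (- c - sqrt (c^2 - 3 * b * d)) / b"

definition double_root_locmin :: "real \<Rightarrow> real \<Rightarrow> real \<Rightarrow> real \<Rightarrow> real \<Rightarrow> bool" where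
  "double_root_locmin a b c d t \<longleftrightarrow> t > 0 \<and> Ppoly a b c d t = 0 \<and> Pderiv a b c t = 0 \<and>
     (\<exists>e>0. \<forall>s. \<bar>s - t\<bar> < e \<longrightarrow> Ppoly a b c d t \<le> Ppoly a b c d s)"

definition double_root_locmax :: "real \<Rightarrow> real \<Rightarrow> real \<Rightarrow> real \<Rightarrow> real \<Rightarrow> bool" where
  "double_root_locmax a b c d t \<longleftrightarrow> t > 0 \<and> Ppoly a b c d t = 0 \<and> Pderiv a b c t = 0 \<and>
     (\<exists>e>0. \<forall>s. \<bar>s - t\<bar> < e \<longrightarrow> Ppoly a b c d s \<le> Ppoly a b c d t)"

definition c_m :: "real \<Rightarrow> real \<Rightarrow> real \<Rightarrow> real" where
  "c_m a b d = Inf {c. c_b a b < c \<and> (\<exists>t. double_root_locmin a b c d t)}"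

definition c_M :: "real \<Rightarrow> real \<Rightarrow> real \<Rightarrow> real" where
  "c_M a b d = Inf {c. c_b a b < c \<and> (\<exists>t. double_root_locmax a b c d t)}"

definition is_2cycle :: "(real \<Rightarrow> real) \<Rightarrow> real \<Rightarrow> real \<Rightarrow> bool" where
  "is_2cycle f p q \<longleftrightarrow> p > 0 \<and> q > 0 \<and> p \<noteq> q \<and> f p = q \<and> f q = p"

definition positive_solution :: "(real \<Rightarrow> real) \<Rightarrow> (nat \<Rightarrow> real) \<Rightarrow> bool" where
  "positive_solution f t \<longleftrightarrow> t 0 > 0 \<and> (\<forall>n. t (Suc n) = f (t n))"

definition converges_to_2cycle :: "(nat \<Rightarrow> real) \<Rightarrow> real \<Rightarrow> real \<Rightarrow> bool" where
  "converges_to_2cycle t p q \<longleftrightarrow>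
     ((\<lambda>n. t (2*n)) \<longlonglongrightarrow> p \<and> (\<lambda>n. t (2*n+1)) \<longlonglongrightarrow> q) \<or>
     ((\<lambda>n. t (2*n)) \<longlonglongrightarrow> q \<and> (\<lambda>n. t (2*n+1)) \<longlonglongrightarrow> p)"

end

theory Submission
  imports Defs
begin

text \<open>
  A positive point is an equilibrium iff \<open>P(t)/t = 0\<close>, and \<open>P(t)/t + c\<close> is independent of \<open>c\<close>.
  If there are exactly two equilibria, \<open>P\<close> has constant sign between them. A negative sign produces
  a double root of local minimum type at a smaller parameter, so \<open>c \<noteq> c_m\<close>; a positive sign
  produces the only double root of local maximum type, at a larger parameter, so \<open>c \<noteq> c_M\<close>. Hence
  \<open>t2\<close> is the double root if \<open>c = c_m\<close>, and \<open>t1\<close> is if \<open>c = c_M\<close>.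

  If \<open>T \<le> a\<close> is the double root and \<open>f \<delta> = T\<close> with \<open>\<delta> < xm\<close>, then
  \<open>f x - T = (x - \<delta>) (x - T) (A x + \<kappa>) / x\<^sup>3\<close> with \<open>A \<ge> 0\<close> and \<open>\<kappa> > 0\<close>, which separates the two basins.
  For \<open>c = c_m\<close> orbits starting outside \<open>(\<delta>, t2)\<close> decrease to \<open>t2\<close>, and those starting inside are
  eventually monotone or enter \<open>[f xm, xm]\<close>, where \<open>f\<close> decreases and \<open>f \<circ> f\<close> increases. There the sign of
  \<open>f (f x) - x\<close> decides: it is negative to the right of the last fixed point of \<open>f \<circ> f\<close> below \<open>t2\<close>, and
  a 2-cycle in \<open>(0, xm]\<close> has multiplier less than \<open>1\<close>, which fixes the sign to its left.
  For \<open>c = c_M\<close> orbits starting in \<open>[\<delta>, t1]\<close> increase to \<open>t1\<close>, and the remaining ones stay above \<open>t1\<close>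
  after one step, where \<open>\<bar>ln x - ln t2\<bar>\<close> decreases along orbits.
\<close>

section \<open>Orbits of continuous maps\<close>

lemma orbit_limit_fixed:
  fixes y :: "nat \<Rightarrow> real"
  assumes step: "\<And>n. y (Suc n) = g (y n)" and L: "y \<longlonglongrightarrow> L" and cont: "isCont g L"
  shows "g L = L"
proof -
  have "(\<lambda>n. y (Suc n)) \<longlonglongrightarrow> g L"
    using isCont_tendsto_compose[OF cont L] by (simp add: step)
  with LIMSEQ_Suc[OF L] show ?thesis using LIMSEQ_unique by blast
qed

text \<open>A bounded monotone orbit converges to a fixed point of \<open>g\<close>, and
  \<open>g x < x\<close> above \<open>z\<close> leaves only \<open>z\<close>.\<close>

lemma decreasing_orbit_tendsto:
  fixes y :: "nat \<Rightarrow> real"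
  assumes step: "\<And>n. y (Suc n) = g (y n)" and z: "z \<le> y 0" "g z = z"
    and below: "\<And>x. z < x \<Longrightarrow> x \<le> y 0 \<Longrightarrow> z \<le> g x \<and> g x < x"
    and cont: "\<And>x. z \<le> x \<Longrightarrow> x \<le> y 0 \<Longrightarrow> isCont g x"
  shows "y \<longlonglongrightarrow> z"
proof -
  have g: "z \<le> g x \<and> g x \<le> x" if "z \<le> x" "x \<le> y 0" for x
    using below[of x] z that by (cases "x = z") auto
  have bounds: "z \<le> y n \<and> y n \<le> y 0" for n
  proof (induction n)
    case (Suc n)
    then show ?case using g[of "y n"] step[of n] by linarith
  qed (use z in simp)
  have dec: "decseq y"
    using g bounds step by (intro decseq_SucI) auto
  obtain L where L: "y \<longlonglongrightarrow> L"
    using decseq_convergent[OF dec, of z] bounds by blast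
  have L_bounds: "z \<le> L" "L \<le> y 0"
    using L bounds by (meson LIMSEQ_le_const LIMSEQ_le_const2)+
  have "g L = L" using orbit_limit_fixed[OF step L] cont L_bounds by blast
  then have "L = z" using below[of L] L_bounds by force
  then show ?thesis using L by simp
qed

lemma increasing_orbit_tendsto:
  fixes y :: "nat \<Rightarrow> real"
  assumes step: "\<And>n. y (Suc n) = g (y n)" and z: "y 0 \<le> z" "g z = z"
    and above: "\<And>x. y 0 \<le> x \<Longrightarrow> x < z \<Longrightarrow> x < g x \<and> g x \<le> z"
    and cont: "\<And>x. y 0 \<le> x \<Longrightarrow> x \<le> z \<Longrightarrow> isCont g x"
  shows "y \<longlonglongrightarrow> z"
proof -
  \<comment> \<open>Reflection x -> -x turns the orbit of \<open>g\<close> into a decreasing orbit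
    of the conjugate map.\<close>
  have "(\<lambda>n. - y n) \<longlonglongrightarrow> - z"
  proof (rule decreasing_orbit_tendsto[where g = "\<lambda>x. - g (- x)"])
    fix x assume "- z \<le> x" "x \<le> - y 0"
    then have "isCont g (- x)" by (intro cont) auto
    then show "isCont (\<lambda>x. - g (- x)) x"
      by (intro continuous_intros isCont_o2[where f = uminus])
  next
    fix x assume "- z < x" "x \<le> - y 0"
    then show "- z \<le> - g (- x) \<and> - g (- x) < x" using above[of "- x"] by auto
  qed (use step z in auto)
  then show ?thesis using tendsto_minus_cancel by blast
qed

text \<open>\<open>V\<close> decreases along the orbit to a limit \<open>L\<close>. If a subsequence
  tends to \<open>w\<close>, then \<open>V w\<close> and \<open>V (g w)\<close> both equal
  \<open>L\<close>, so strict decrease away from \<open>z\<close> forces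
  \<open>w = z\<close>.\<close>

lemma lyapunov_tendsto:
  fixes y :: "nat \<Rightarrow> real" and V g :: "real \<Rightarrow> real"
  assumes step: "\<And>n. y (Suc n) = g (y n)" and y: "\<And>n. l \<le> y n \<and> y n \<le> u"
    and cont: "\<And>x. l \<le> x \<Longrightarrow> x \<le> u \<Longrightarrow> isCont g x \<and> isCont V x"
    and nonneg: "\<And>x. V x \<ge> 0" and z: "g z = z"
    and less: "\<And>x. l \<le> x \<Longrightarrow> x \<le> u \<Longrightarrow> x \<noteq> z \<Longrightarrow> V (g x) < V x"
  shows "(\<lambda>n. V (y n)) \<longlonglongrightarrow> V z"
proof -
  have le: "V (g x) \<le> V x" if "l \<le> x" "x \<le> u" for x
    using less[OF that] z by (cases "x = z") auto
  have dec: "decseq (\<lambda>n. V (y n))"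
    using le y step by (intro decseq_SucI) auto
  obtain L where L: "(\<lambda>n. V (y n)) \<longlonglongrightarrow> L"
    using decseq_convergent[OF dec, of 0] nonneg by blast
  obtain r where r: "strict_mono r" and mono: "monoseq (\<lambda>n. y (r n))"
    using seq_monosub[of y] by blast
  have "Bseq (\<lambda>n. y (r n))"
    using y by (intro BseqI'[of _ "\<bar>l\<bar> + \<bar>u\<bar>"]) (smt (verit) real_norm_def)
  then obtain w where lim': "(\<lambda>n. y (r n)) \<longlonglongrightarrow> w"
    using Bseq_monoseq_convergent[OF _ mono] by (auto simp: convergent_def)
  have w: "w \<in> {l..u}"
    using lim' y by (auto intro: LIMSEQ_le_const LIMSEQ_le_const2)
  \<comment> \<open>Needed for the continuity of \<open>V\<close> at \<open>g w\<close>.\<close>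
  have gw: "l \<le> g w" "g w \<le> u"
  proof -
    have "(\<lambda>n. y (Suc (r n))) \<longlonglongrightarrow> g w"
      using isCont_tendsto_compose[OF _ lim', of g] cont w by (simp add: step)
    then show "l \<le> g w" "g w \<le> u"
      using y by (meson LIMSEQ_le_const LIMSEQ_le_const2)+
  qed
  have "(\<lambda>n. V (y (r n))) \<longlonglongrightarrow> V w"
    using isCont_tendsto_compose[OF _ lim', of V] cont w by simp
  moreover have "(\<lambda>n. V (y (r n))) \<longlonglongrightarrow> L"
    using LIMSEQ_subseq_LIMSEQ[OF L r] by (simp add: o_def)
  ultimately have 1: "V w = L" using LIMSEQ_unique by blast
  have "(\<lambda>n. g (y (r n))) \<longlonglongrightarrow> g w"
    using isCont_tendsto_compose[OF _ lim', of g] cont w by simp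
  then have "(\<lambda>n. V (y (Suc (r n)))) \<longlonglongrightarrow> V (g w)"
    using isCont_tendsto_compose[of "g w" V] cont gw by (simp add: step)
  moreover have "(\<lambda>n. V (y (Suc (r n)))) \<longlonglongrightarrow> L"
    using LIMSEQ_subseq_LIMSEQ[OF LIMSEQ_Suc[OF L] r] by (simp add: o_def)
  ultimately have "V (g w) = L" using LIMSEQ_unique by blast
  then have "w = z" using less[of w] w 1 by force
  then show ?thesis using L 1 by simp
qed

section \<open>Convergence to 2-cycles: shifts and parity\<close>

lemma converges_to_2cycle_offset:
  assumes "converges_to_2cycle (\<lambda>n. t (n + k)) p q"
  shows "converges_to_2cycle t p q"
  using assms
proof (induction k)
  case (Suc k)
  let ?s = "\<lambda>n. t (n + k)"
  \<comment> \<open>The odd terms of the sequence shifted by \<open>Suc k\<close> are the even terms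
    of \<open>?s\<close> from index 2 on. The parities swap, which the symmetric notion of
    convergence absorbs.\<close>
  have shift: "(\<lambda>n. ?s (2 * n)) \<longlonglongrightarrow> x" if "(\<lambda>n. t (2 * n + 1 + Suc k)) \<longlonglongrightarrow> x" for x
    by (rule LIMSEQ_imp_Suc) (use that in \<open>simp add: algebra_simps\<close>)
  have "converges_to_2cycle ?s p q"
    using Suc.prems shift by (auto simp: converges_to_2cycle_def)
  then show ?case by (rule Suc.IH)
qed simp

lemma tendsto_of_even_odd:
  fixes t :: "nat \<Rightarrow> real"
  assumes even: "(\<lambda>n. t (2 * n)) \<longlonglongrightarrow> x" and odd: "(\<lambda>n. t (2 * n + 1)) \<longlonglongrightarrow> x"
  shows "t \<longlonglongrightarrow> x"
proof (rule LIMSEQ_I)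
  fix e :: real assume "e > 0"
  then obtain M N where M: "\<And>n. n \<ge> M \<Longrightarrow> norm (t (2 * n) - x) < e"
    and N: "\<And>n. n \<ge> N \<Longrightarrow> norm (t (2 * n + 1) - x) < e"
    using LIMSEQ_D[OF even] LIMSEQ_D[OF odd] by metis
  have "norm (t n - x) < e" if "n \<ge> 2 * (M + N) + 1" for n
  proof (cases "even n")
    case True
    then obtain k where "n = 2 * k" by (elim evenE)
    then show ?thesis using M[of k] that by simp
  next
    case False
    then obtain k where "n = 2 * k + 1" by (elim oddE)
    then show ?thesis using N[of k] that by simp
  qed
  then show "\<exists>n0. \<forall>n\<ge>n0. norm (t n - x) < e" by blast
qed

text \<open>Lets the case without 2-cycles be treated as the degenerate cycle (t1, t1).\<close>

lemma converges_to_2cycle_refl: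
  "converges_to_2cycle t x x \<Longrightarrow> t \<longlonglongrightarrow> x"
  unfolding converges_to_2cycle_def by (auto intro: tendsto_of_even_odd)

section \<open>Double roots and the critical parameters\<close>

lemma isCont_same_sign:
  fixes F :: "real \<Rightarrow> real"
  assumes cont: "\<And>x. l < x \<Longrightarrow> x < r \<Longrightarrow> isCont F x"
    and nz: "\<And>x. l < x \<Longrightarrow> x < r \<Longrightarrow> F x \<noteq> 0"
    and x: "l < x" "x < r" "F x > 0" and y: "l < y" "y < r"
  shows "F y > 0"
proof (rule ccontr)
  assume "\<not> F y > 0"
  then have neg: "F y < 0" using nz[OF y] by simp
  consider "x < y" | "y < x" using x neg by fastforce
  then obtain w where "l < w" "w < r" "F w = 0"
  proof cases
    case 1
    then show ?thesis using IVT2[of F y 0 x] cont x y neg that by (smt (verit))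
  next
    case 2
    then show ?thesis using IVT[of F y 0 x] cont x y neg that by (smt (verit))
  qed
  then show False using nz by blast
qed

section \<open>The discriminants \<open>Qpoly\<close> and \<open>Hpoly\<close> and the thresholds
  they define\<close>

lemma cubic_pos_of_Qpoly_pos:
  fixes a b c d :: real
  assumes a: "a > 0" and d: "d > 0" and Q: "Qpoly a b d c > 0" and x: "x > 0"
  shows "a * x^3 + b * x^2 + c * x + d > 0"
proof (rule ccontr)
  let ?N = "\<lambda>x. a * x^3 + b * x^2 + c * x + d"
  assume "\<not> ?N x > 0"
  moreover have "\<forall>y. 0 \<le> y \<and> y \<le> x \<longrightarrow> isCont ?N y" by (auto intro!: continuous_intros)
  ultimately obtain w where w: "0 \<le> w" "w \<le> x" "?N w = 0"
    using IVT2[of ?N x 0 0] x d by auto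
  have "w > 0" using w d by (cases "w = 0") auto
  (* -Q(c) is the discriminant of the cubic, and dividing out the root w leaves the quadratic
     a X^2 + \<beta> X - d/w, which has positive discriminant. *)
  define \<beta> where "\<beta> = b + a * w"
  define \<gamma> where "\<gamma> = - d / w"
  have d_eq: "d = - \<gamma> * w" using \<open>w > 0\<close> by (simp add: \<gamma>_def)
  have b_eq: "b = \<beta> - a * w" by (simp add: \<beta>_def)
  have "w * (c - (\<gamma> - \<beta> * w)) = ?N w"
    unfolding b_eq d_eq by algebra
  then have c_eq: "c = \<gamma> - \<beta> * w" using w \<open>w > 0\<close> by simp
  \<comment> \<open>Discriminant of the quadratic quotient times its squared value at
    \<open>w\<close>.\<close>
  have "- Qpoly a b d c = (\<beta>^2 - 4 * a * \<gamma>) * (a * w^2 + \<beta> * w + \<gamma>)^2"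
    unfolding Qpoly_def b_eq d_eq c_eq by algebra
  moreover have "\<gamma> < 0" using d \<open>w > 0\<close> by (simp add: \<gamma>_def)
  then have "a * \<gamma> < 0" using a by (simp add: mult_pos_neg)
  then have "\<beta>^2 - 4 * a * \<gamma> \<ge> 0" using zero_le_power2[of \<beta>] by linarith
  ultimately show False using Q by (smt (verit) mult_nonneg_nonneg zero_le_power2)
qed

text \<open>As Q(0) > 0, a nonpositive value at \<open>c\<close> would give a root in [c, 0). It is
  the only negative root, hence equals \<open>c_minus\<close>, which lies below
  \<open>c\<close>.\<close>

lemma Qpoly_pos:
  fixes a b c d :: real
  assumes a: "a > 0" and b: "b > 0" and d: "d > 0" and c: "c_minus a b d < c" "c < 0"
  shows "Qpoly a b d c > 0"
proof (rule ccontr)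
  assume "\<not> Qpoly a b d c > 0"
  moreover have "Qpoly a b d 0 > 0" using a b d by (simp add: Qpoly_def add_pos_pos)
  moreover have "\<forall>x. c \<le> x \<and> x \<le> 0 \<longrightarrow> isCont (Qpoly a b d) x"
    unfolding Qpoly_def by (auto intro!: continuous_intros)
  ultimately obtain r where r: "c \<le> r" "r \<le> 0" "Qpoly a b d r = 0"
    using IVT[of "Qpoly a b d" c 0 0] c by auto
  have "r < 0" using r \<open>Qpoly a b d 0 > 0\<close> by (cases "r = 0") auto
  have "s = r" if s: "s < 0" "Qpoly a b d s = 0" for s
  proof -
    define K where "K = 27 * a^2 * d^2 + 4 * d * b^3"
    have K: "K > 0" using a b d by (simp add: K_def add_pos_pos)
    \<comment> \<open>This combination removes the linear term of Q; for negative \<open>r\<close>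
      and \<open>s\<close> the second factor is negative.\<close>
    have "s * Qpoly a b d r - r * Qpoly a b d s
        = (r - s) * (s * r * (4 * a * (r + s) - b^2) - K)"
      unfolding Qpoly_def K_def by algebra
    then have zero: "(r - s) * (s * r * (4 * a * (r + s) - b^2) - K) = 0"
      unfolding r(3) s(2) by simp
    have "a * (r + s) < 0" using a s \<open>r < 0\<close> by (simp add: mult_pos_neg)
    then have "4 * a * (r + s) - b^2 < 0" using zero_le_power2[of b] by linarith
    moreover have "s * r > 0" using s \<open>r < 0\<close> by (simp add: mult_neg_neg)
    ultimately have "s * r * (4 * a * (r + s) - b^2) < 0" by (rule mult_pos_neg[rotated])
    then have "s * r * (4 * a * (r + s) - b^2) - K \<noteq> 0" using K by linarith
    with zero have "r - s = 0" by (metis mult_eq_0_iff)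
    then show ?thesis by simp
  qed
  then have "c_minus a b d = r"
    unfolding c_minus_def using r \<open>r < 0\<close> by (intro the_equality) blast+
  then show False using r c by simp
qed

text \<open>H is a convex quadratic with negative constant term, so it is negative between its only
  negative root and 0.\<close>

lemma c_b_less:
  fixes a b c :: real
  assumes a: "a > 0" and b: "b > 0" and H: "Hpoly a b c < 0" and c: "c < 0"
  shows "c_b a b < c"
proof -
  define B where "B = 108 * a * b + 27 * a^3"
  define K where "K = 9 * a^2 * b^2 + 32 * b^3"
  have B: "B > 0" and K: "K > 0" using a b by (simp_all add: B_def K_def add_pos_pos)
  have H_eq: "Hpoly a b x = 108 * x^2 + B * x - K" for x
    unfolding Hpoly_def B_def K_def by algebra
  \<comment> \<open>Chosen with \<open>M \<ge> 1\<close>, \<open>M \<ge> B + K\<close> and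
    \<open>- M < c\<close>, so that M^2 dominates B M + K.\<close>
  define M where "M = B + K + 1 - c"
  have M: "M \<ge> 1" "M \<ge> B + K" "- M < c" using B K c by (simp_all add: M_def)
  have "108 * M^2 - B * M - K \<ge> 0"
  proof -
    have "K * 1 \<le> K * M" using K M by (intro mult_left_mono) auto
    moreover have "(B + K) * M \<le> M * M" using M B K by (intro mult_right_mono) auto
    ultimately show ?thesis
      using zero_le_square[of M] unfolding power2_eq_square distrib_right by linarith
  qed
  then have "Hpoly a b (- M) \<ge> 0" unfolding H_eq by simp
  moreover have "\<forall>x. - M \<le> x \<and> x \<le> c \<longrightarrow> isCont (Hpoly a b) x"
    unfolding Hpoly_def by (auto intro!: continuous_intros)
  ultimately obtain r where r: "- M \<le> r" "r \<le> c" "Hpoly a b r = 0"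
    using IVT2[of "Hpoly a b" c 0 "- M"] H M by auto
  have "r < c" using r H by (cases "r = c") auto
  have "s = r" if s: "s < 0" "Hpoly a b s = 0" for s
  proof -
    have "s * Hpoly a b r - r * Hpoly a b s = (r - s) * (108 * (s * r) + K)"
      unfolding H_eq by algebra
    moreover have "s * r > 0" using s \<open>r < c\<close> c by (simp add: mult_neg_neg)
    ultimately show ?thesis using r s K by simp
  qed
  then have "c_b a b = r"
    unfolding c_b_def using r \<open>r < c\<close> c by (intro the_equality) (blast intro: less_trans)+
  then show ?thesis using \<open>r < c\<close> by simp
qed

lemma Hpoly_neg_of_double_root:
  fixes a b c d :: real
  assumes d: "d > 0" and s: "s > 0" and root: "Ppoly a b c d s = 0" "Pderiv a b c s = 0"
    and \<rho>: "0 < \<rho>" "\<rho> \<noteq> s" "Ppoly a b c d \<rho> = 0"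
  shows "Hpoly a b c < 0"
proof -
  (* P(t) = (t - s)^2 (t^2 + \<alpha> t + \<beta>) with \<beta> < 0, so all roots of P are real; -4 H(c) is the
     discriminant of P'. *)
  define \<alpha> where "\<alpha> = 2 * s - a"
  define \<beta> where "\<beta> = - d / s^2"
  have \<beta>: "\<beta> < 0" using d s by (simp add: \<beta>_def)
  have d_eq: "d = - \<beta> * s^2" using s by (simp add: \<beta>_def)
  have a_eq: "a = 2 * s - \<alpha>" by (simp add: \<alpha>_def)
  \<comment> \<open>The parameter \<open>c\<close> cancels in P(s) - s P'(s).\<close>
  have "s^2 * (b + (s^2 - 2 * s * \<alpha> + \<beta>)) = Ppoly a b c d s - s * Pderiv a b c s"
    unfolding Ppoly_def Pderiv_def a_eq d_eq by algebra
  then have b_eq: "b = - (s^2 - 2 * s * \<alpha> + \<beta>)" using root s by simp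
  have c_eq: "c = 2 * s * \<beta> - s^2 * \<alpha>"
    using root(2) unfolding Pderiv_def a_eq b_eq by algebra
  have "Ppoly a b c d \<rho> = (\<rho> - s)^2 * (\<rho>^2 + \<alpha> * \<rho> + \<beta>)"
    unfolding Ppoly_def a_eq b_eq c_eq d_eq by algebra
  then have q: "\<rho>^2 + \<alpha> * \<rho> + \<beta> = 0" using \<rho> by simp
  \<comment> \<open>Since \<beta> < 0, the quadratic factor has \<rho> as its only positive root. So
    \<open>s\<close> is not a triple root of P, which makes the inequality for H strict.\<close>
  have "\<rho> * (s^2 + \<alpha> * s + \<beta>) = (s - \<rho>) * (s * \<rho> - \<beta>)" using q by algebra
  moreover have "s * \<rho> - \<beta> > 0" using s \<rho> \<beta> by (smt (verit) mult_pos_pos)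
  ultimately have "s^2 + \<alpha> * s + \<beta> \<noteq> 0" using \<rho> by auto
  moreover have "Hpoly a b c
      = - ((9 * \<alpha>^2 + 4 * \<alpha> * s + 4 * s^2 - 32 * \<beta>) * (s^2 + \<alpha> * s + \<beta>)^2)"
    unfolding Hpoly_def a_eq b_eq c_eq by algebra
  moreover have "9 * \<alpha>^2 + 4 * \<alpha> * s + 4 * s^2 = 8 * \<alpha>^2 + (\<alpha> + 2 * s)^2" by algebra
  then have "9 * \<alpha>^2 + 4 * \<alpha> * s + 4 * s^2 - 32 * \<beta> > 0"
    using \<beta> zero_le_power2[of \<alpha>] zero_le_power2[of "\<alpha> + 2 * s"] by linarith
  ultimately show ?thesis by simp
qed

text \<open>The polynomial is x P'(x) - P(x), which is free of \<open>c\<close>: its positive zeros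
  are the possible double roots over all parameters. For three distinct zeros, eliminating
  \<open>b\<close> and then \<open>a\<close> equates a positive quantity to 0.\<close>

lemma at_most_two_double_root_candidates:
  fixes a b d :: real
  assumes d: "d > 0" and pos: "0 < x" "0 < y" "0 < z"
    and roots: "3 * x^4 - 2 * a * x^3 - b * x^2 + d = 0"
      "3 * y^4 - 2 * a * y^3 - b * y^2 + d = 0" "3 * z^4 - 2 * a * z^3 - b * z^2 + d = 0"
  shows "x = y \<or> x = z \<or> y = z"
proof (rule ccontr)
  assume ne: "\<not> (x = y \<or> x = z \<or> y = z)"
  have slope: "(3 * (x + w) - 2 * a) * (x^2 * w^2) = d * (x + w)"
    if "3 * w^4 - 2 * a * w^3 - b * w^2 + d = 0" "x \<noteq> w" for w
  proof -
    have "(x - w) * ((3 * (x + w) - 2 * a) * (x^2 * w^2) - d * (x + w))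
        = w^2 * (3 * x^4 - 2 * a * x^3 - b * x^2 + d)
          - x^2 * (3 * w^4 - 2 * a * w^3 - b * w^2 + d)"
      by algebra
    then show ?thesis unfolding roots(1) that(1) using that(2) by simp
  qed
  have "(z - y) * (3 * x^2 * y^2 * z^2 + d * (x * (y + z) + y * z))
      = y^2 * ((3 * (x + z) - 2 * a) * (x^2 * z^2) - d * (x + z))
        - z^2 * ((3 * (x + y) - 2 * a) * (x^2 * y^2) - d * (x + y))"
    by algebra
  also have "\<dots> = 0" using slope[OF roots(2)] slope[OF roots(3)] ne by auto
  finally have "3 * x^2 * y^2 * z^2 + d * (x * (y + z) + y * z) = 0" using ne by simp
  moreover have "3 * x^2 * y^2 * z^2 + d * (x * (y + z) + y * z) > 0"
    using pos d by (intro add_pos_pos mult_pos_pos) auto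
  ultimately show False by simp
qed

lemma isCont_Ppoly: "isCont (Ppoly a b c d) x"
  unfolding Ppoly_def by (intro continuous_intros)

lemma DERIV_Ppoly: "DERIV (Ppoly a b c d) x :> Pderiv a b c x"
  unfolding Ppoly_def Pderiv_def
  by (auto intro!: derivative_eq_intros simp: power2_eq_square power3_eq_cube)

lemma Ppoly_change_c: "Ppoly a b c' d t = Ppoly a b c d t + (c - c') * t"
  unfolding Ppoly_def by algebra

section \<open>Quartics with exactly two positive roots, and the position of \<open>c\<close>
  relative to \<open>c_m\<close> and \<open>c_M\<close>\<close>

locale two_roots =
  fixes a b c d t1 t2 :: real
  assumes a: "a > 0" and b: "b > 0" and d: "d > 0" and c: "c < 0"
    and roots: "\<And>x. x > 0 \<Longrightarrow> Ppoly a b c d x = 0 \<longleftrightarrow> x = t1 \<or> x = t2"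
    and t1: "0 < t1" and t12: "t1 < t2"
begin

abbreviation "P \<equiv> Ppoly a b c d"

lemma P_left: "P x < 0" if x: "0 < x" "x < t1"
proof (rule ccontr)
  assume "\<not> P x < 0"
  moreover have "P 0 < 0" using d by (simp add: Ppoly_def)
  ultimately obtain w where "0 \<le> w" "w \<le> x" "P w = 0"
    using IVT[of P 0 0 x] x isCont_Ppoly by auto
  moreover from this have "w \<noteq> 0" using d by (auto simp: Ppoly_def)
  ultimately show False using roots[of w] x t12 by auto
qed

lemma P_right: "P x > 0" if "t2 < x"
proof (rule ccontr)
  assume neg: "\<not> P x > 0"
  \<comment> \<open>For M >= 1 the terms below M^4 are bounded by S M^3, so any M > S makes P(M)
    positive.\<close>
  define S where "S = a + b - c + d"
  define M where "M = x + 1 + S"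
  have "S > 0" using a b c d by (simp add: S_def)
  then have M: "M \<ge> 1" "M > S" "M > x" using that t1 t12 by (simp_all add: M_def)
  have M3: "M^2 \<le> M^3" "M \<le> M^3" "1 \<le> M^3"
    using M power_increasing[of _ 3 M] power_increasing[of 1 3 M] one_le_power[of M 3] by auto
  have "b * M^2 \<le> b * M^3" "- c * M \<le> - c * M^3" "d * 1 \<le> d * M^3"
    using b c d M3 by (auto intro!: mult_left_mono)
  moreover have "M^4 = S * M^3 + M^3 * (M - S)" by algebra
  moreover have "M^3 * (M - S) > 0" using M by simp
  moreover have "S * M^3 = a * M^3 + b * M^3 + - c * M^3 + d * M^3" unfolding S_def by algebra
  moreover have "c * M < 0" "c * M^3 < 0" using c M by (simp_all add: mult_neg_pos)
  moreover have "a * M^3 > 0" using a M by simp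
  ultimately have "P M > 0" unfolding Ppoly_def mult_minus_left by linarith
  then obtain w where "x \<le> w" "P w = 0"
    using IVT[of P x 0 M] neg M isCont_Ppoly by auto
  then show False using roots[of w] that t1 t12 by auto
qed

lemma P_between: "(\<forall>x. t1 < x \<and> x < t2 \<longrightarrow> P x > 0) \<or> (\<forall>x. t1 < x \<and> x < t2 \<longrightarrow> P x < 0)"
proof -
  have "P x \<noteq> 0" if "t1 < x" "x < t2" for x using roots[of x] that t1 by auto
  then show ?thesis
    using isCont_same_sign[of t1 t2 P] isCont_Ppoly by (metis linorder_neqE_linordered_idom)
qed

lemma double_root_t2:
  assumes pos: "\<And>x. t1 < x \<Longrightarrow> x < t2 \<Longrightarrow> P x > 0"
  shows "Pderiv a b c t2 = 0"
proof (rule DERIV_local_min[OF DERIV_Ppoly[where d = d], of "t2 - t1"])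
  have P2: "P t2 = 0" using roots t1 t12 by auto
  show "\<forall>y. \<bar>t2 - y\<bar> < t2 - t1 \<longrightarrow> P t2 \<le> P y"
  proof (intro allI impI)
    fix y assume "\<bar>t2 - y\<bar> < t2 - t1"
    then have "t1 < y" by linarith
    then show "P t2 \<le> P y"
      using pos[of y] P_right[of y] P2 by (cases y t2 rule: linorder_cases) auto
  qed
qed (use t12 in simp)

lemma double_root_t1:
  assumes neg: "\<And>x. t1 < x \<Longrightarrow> x < t2 \<Longrightarrow> P x < 0"
  shows "Pderiv a b c t1 = 0"
proof (rule DERIV_local_max[OF DERIV_Ppoly[where d = d], of "min t1 (t2 - t1)"])
  have P1: "P t1 = 0" using roots t1 by auto
  show "\<forall>y. \<bar>t1 - y\<bar> < min t1 (t2 - t1) \<longrightarrow> P y \<le> P t1"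
  proof (intro allI impI)
    fix y assume "\<bar>t1 - y\<bar> < min t1 (t2 - t1)"
    then have "0 < y" "y < t2" by linarith+
    then show "P y \<le> P t1"
      using neg[of y] P_left[of y] P1 by (cases y t1 rule: linorder_cases) auto
  qed
qed (use t1 t12 in simp)

text \<open>P(t)/t has a negative minimum at some \<open>s\<close> between the roots. Raising the
  graph of P(t)/t by its depth, that is, lowering \<open>c\<close> to \<open>c'\<close>, makes
  \<open>s\<close> a double root of local minimum type, so \<open>c_m\<close> is at most
  \<open>c'\<close>.\<close>

lemma P_neg_extremum:
  assumes neg: "\<And>x. t1 < x \<Longrightarrow> x < t2 \<Longrightarrow> P x < 0"
  shows "c_m a b d < c"
proof -
  let ?g = "\<lambda>x. P x / x"
  have "continuous_on {t1..t2} ?g"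
    using t1 by (intro continuous_on_divide continuous_at_imp_continuous_on) (auto simp: isCont_Ppoly)
  then obtain s where s: "s \<in> {t1..t2}" and min: "\<And>x. x \<in> {t1..t2} \<Longrightarrow> ?g s \<le> ?g x"
    using continuous_attains_inf[of "{t1..t2}" ?g] t12 by auto
  have "P ((t1 + t2) / 2) < 0" using neg t12 by auto
  then have "?g ((t1 + t2) / 2) < 0" using t1 t12 by (simp add: divide_less_0_iff)
  then have gs: "?g s < 0" using min[of "(t1 + t2) / 2"] t12 by auto
  have st: "t1 < s" "s < t2"
    using s gs roots[of t1] roots[of t2] t1 t12 by (auto simp: order_le_less)
  define c' where "c' = c + ?g s"
  have P': "Ppoly a b c' d x = x * (?g x - ?g s)" if "x > 0" for x
    using Ppoly_change_c[of a b c' d x c] that by (simp add: c'_def right_diff_distrib)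
  define e where "e = min (s - t1) (t2 - s)"
  have e: "e > 0" using st by (simp add: e_def)
  have nonneg: "Ppoly a b c' d x \<ge> 0" if "\<bar>x - s\<bar> < e" for x
  proof -
    have "x \<in> {t1..t2}" using that by (auto simp: e_def)
    then show ?thesis using min[of x] t1 by (simp add: P')
  qed
  have s0: "Ppoly a b c' d s = 0" using st t1 by (simp add: P')
  have s1: "Pderiv a b c' s = 0"
    by (rule DERIV_local_min[OF DERIV_Ppoly[where d = d] e]) (auto simp: s0 abs_minus_commute[of s] intro!: nonneg)
  have locmin: "double_root_locmin a b c' d s"
    unfolding double_root_locmin_def using s0 s1 st t1 nonneg e by auto
  \<comment> \<open>A second positive root \<rho> gives \<open>Hpoly a b c' < 0\<close>, hence
    \<open>c_b a b < c'\<close>, as membership in the set defining \<open>c_m\<close>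
    requires.\<close>
  have Pc0: "Ppoly a b c' d 0 < 0" using d by (simp add: Ppoly_def)
  have "t1 * (?g t1 - ?g s) > 0" using gs roots[of t1] t1 by (intro mult_pos_pos) auto
  then have "Ppoly a b c' d t1 > 0" by (simp only: P'[OF t1])
  then obtain \<rho> where \<rho>: "0 \<le> \<rho>" "\<rho> \<le> t1" "Ppoly a b c' d \<rho> = 0"
    using IVT[of "Ppoly a b c' d" 0 0 t1] t1 Pc0 isCont_Ppoly by auto
  have "\<rho> \<noteq> 0" using \<rho> Pc0 by auto
  then have "Hpoly a b c' < 0"
    using Hpoly_neg_of_double_root[OF d _ s0 s1, of \<rho>] \<rho> st t1 by auto
  then have "c_b a b < c'" using c_b_less[of a b c'] a b c gs by (simp add: c'_def)
  then have "c_m a b d \<le> c'"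
    unfolding c_m_def using locmin by (intro cInf_lower) (auto intro!: bdd_belowI[of _ "c_b a b"])
  then show ?thesis using gs by (simp add: c'_def)
qed

text \<open>The positive maximum of P(t)/t between the roots yields a double root of local maximum
  type at some \<open>c' > c\<close>. To bound the infimum \<open>c_M\<close> from below, this must
  be the only such parameter: double roots can sit only at \<open>s\<close> and
  \<open>t2\<close>.\<close>

lemma P_pos_extremum:
  assumes pos: "\<And>x. t1 < x \<Longrightarrow> x < t2 \<Longrightarrow> P x > 0"
  shows "c < c_M a b d"
proof -
  let ?g = "\<lambda>x. P x / x"
  have "continuous_on {t1..t2} ?g"
    using t1 by (intro continuous_on_divide continuous_at_imp_continuous_on) (auto simp: isCont_Ppoly)
  then obtain s where s: "s \<in> {t1..t2}" and max: "\<And>x. x \<in> {t1..t2} \<Longrightarrow> ?g x \<le> ?g s"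
    using continuous_attains_sup[of "{t1..t2}" ?g] t12 by auto
  have "P ((t1 + t2) / 2) > 0" using pos t12 by auto
  then have "?g ((t1 + t2) / 2) > 0" using t1 t12 by simp
  then have gs: "?g s > 0" using max[of "(t1 + t2) / 2"] t12 by auto
  have st: "t1 < s" "s < t2"
    using s gs roots[of t1] roots[of t2] t1 t12 by (auto simp: order_le_less)
  define c' where "c' = c + ?g s"
  have P': "Ppoly a b c' d x = x * (?g x - ?g s)" if "x > 0" for x
    using Ppoly_change_c[of a b c' d x c] that by (simp add: c'_def right_diff_distrib)
  define e where "e = min (s - t1) (t2 - s)"
  have e: "e > 0" using st by (simp add: e_def)
  have nonpos: "Ppoly a b c' d x \<le> 0" if "\<bar>x - s\<bar> < e" for x
  proof -
    have "x \<in> {t1..t2}" using that by (auto simp: e_def)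
    then show ?thesis using max[of x] t1 by (simp add: P' mult_nonneg_nonpos)
  qed
  have s0: "Ppoly a b c' d s = 0" using st t1 by (simp add: P')
  have s1: "Pderiv a b c' s = 0"
    by (rule DERIV_local_max[OF DERIV_Ppoly[where d = d] e]) (auto simp: s0 abs_minus_commute[of s] intro!: nonpos)
  have locmax: "double_root_locmax a b c' d s"
    unfolding double_root_locmax_def using s0 s1 st t1 nonpos e by auto
  have P2: "P t2 = 0" using roots t1 t12 by auto
  have D2: "Pderiv a b c t2 = 0" using pos by (rule double_root_t2)
  have "Hpoly a b c < 0"
    using Hpoly_neg_of_double_root[OF d _ P2 D2, of t1] roots[of t1] t1 t12 by auto
  then have cb: "c_b a b < c" using c_b_less a b c by blast
  have "k = c'" if k: "double_root_locmax a b k d y" for k y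
  proof -
    have candidate: "3 * x^4 - 2 * a * x^3 - b * x^2 + d = 0"
      if "Ppoly a b l d x = 0" "Pderiv a b l x = 0" for l x
      using that unfolding Ppoly_def Pderiv_def by algebra
    have y: "y > 0" "Ppoly a b k d y = 0" "Pderiv a b k y = 0"
      using k by (auto simp: double_root_locmax_def)
    have "0 < s" "0 < t2" using st t1 by auto
    then have "s = t2 \<or> s = y \<or> t2 = y"
      by (rule at_most_two_double_root_candidates[OF d _ _ y(1) candidate[OF s0 s1]
            candidate[OF P2 D2] candidate[OF y(2,3)]])
    moreover have "s \<noteq> t2" using st by simp
    ultimately consider "y = s" | "y = t2" by metis
    then show ?thesis
    proof cases
      case 1
      then have "Ppoly a b k d s = 0" using y(2) by simp
      then have "(c' - k) * s = 0" using Ppoly_change_c[of a b k d s c'] s0 by linarith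
      then show ?thesis using \<open>0 < s\<close> by simp
    next
      \<comment> \<open>A double root at \<open>t2\<close> forces \<open>k = c\<close>, but P is
        positive just left of \<open>t2\<close>, so it is no local maximum.\<close>
      case 2
      then have "Ppoly a b k d t2 = 0" using y(2) by simp
      then have "(c - k) * t2 = 0" using Ppoly_change_c[of a b k d t2 c] P2 by linarith
      then have "k = c" using \<open>0 < t2\<close> by simp
      then obtain \<epsilon> where \<epsilon>: "\<epsilon> > 0" "\<And>x. \<bar>x - t2\<bar> < \<epsilon> \<Longrightarrow> P x \<le> 0"
        using k 2 P2 by (auto simp: double_root_locmax_def)
      define x where "x = t2 - min (\<epsilon> / 2) ((t2 - t1) / 2)"
      have "t1 < x" "x < t2" "\<bar>x - t2\<bar> < \<epsilon>"
        using \<epsilon>(1) t12 by (auto simp: x_def min_def field_simps)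
      then show ?thesis using pos[of x] \<epsilon>(2)[of x] by auto
    qed
  qed
  moreover have "c_b a b < c'" using cb gs by (simp add: c'_def)
  ultimately have "{k. c_b a b < k \<and> (\<exists>t. double_root_locmax a b k d t)} = {c'}"
    using locmax by blast
  then have "c_M a b d = c'" unfolding c_M_def by simp
  then show ?thesis using gs by (simp add: c'_def)
qed

text \<open>This says that \<open>phi\<close> has slope 1 at a double root, since phi'(x) = -(b x^2
  + 2 c x + 3 d) / x^4.\<close>

lemma double_root_derivative:
  assumes "P T = 0" "Pderiv a b c T = 0"
  shows "b * T^2 + 2 * c * T + 3 * d = - (T^4)"
  using assms unfolding Ppoly_def Pderiv_def by algebra

end

section \<open>Dynamics with two equilibria\<close>

locale cubic_quotient_map = two_roots +
  assumes disc: "3 * b * d < c^2"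
    and numer_pos: "\<And>x. x > 0 \<Longrightarrow> a * x^3 + b * x^2 + c * x + d > 0"
begin

abbreviation "f \<equiv> phi a b c d"
abbreviation "xm \<equiv> x_m b c d"

section \<open>Shape of \<open>phi\<close>: critical point, monotone branches, level sets\<close>

lemma f_pos: "x > 0 \<Longrightarrow> f x > 0"
  unfolding phi_def using numer_pos by simp

lemma f_eq_minus: "x > 0 \<Longrightarrow> f x = x - P x / x^3"
  by (simp add: phi_def Ppoly_def field_simps eval_nat_numeral)

lemma f_less_iff: "x > 0 \<Longrightarrow> f x < x \<longleftrightarrow> P x > 0"
  and f_greater_iff: "x > 0 \<Longrightarrow> x < f x \<longleftrightarrow> P x < 0"
  and f_eq_iff: "x > 0 \<Longrightarrow> f x = x \<longleftrightarrow> x = t1 \<or> x = t2"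
  using roots by (auto simp: f_eq_minus zero_less_divide_iff divide_less_0_iff)

lemma f_t1: "f t1 = t1" and f_t2: "f t2 = t2"
  using f_eq_iff t1 t12 by auto

lemma isCont_f: "x > 0 \<Longrightarrow> isCont f x"
  unfolding phi_def by (intro continuous_intros) auto

lemma isCont_ff: "x > 0 \<Longrightarrow> isCont (\<lambda>x. f (f x)) x"
  using isCont_o2[OF isCont_f isCont_f[OF f_pos]] by blast

lemma DERIV_f: "x > 0 \<Longrightarrow> DERIV f x :> - (b * x^2 + 2 * c * x + 3 * d) / x^4"
  unfolding phi_def by (auto intro!: derivative_eq_intros simp: field_simps eval_nat_numeral)

text \<open>The quadratic is -x^4 f'(x), and \<open>xm\<close> is its smaller root. The larger root
  is never named: a point \<open>y > xm\<close> with negative value lies before it, and so does all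
  of (xm, y).\<close>

lemma xm_pos: "xm > 0" and xm_upper: "b * xm < - c"
  and xm_root: "b * xm^2 + 2 * c * xm + 3 * d = 0"
  and slope_pos: "0 < x \<Longrightarrow> x < xm \<Longrightarrow> b * x^2 + 2 * c * x + 3 * d > 0"
  and slope_neg: "xm < x \<Longrightarrow> x < y \<Longrightarrow> b * y^2 + 2 * c * y + 3 * d < 0
    \<Longrightarrow> b * x^2 + 2 * c * x + 3 * d < 0"
proof -
  define s where "s = sqrt (c^2 - 3 * b * d)"
  have s: "s > 0" "s^2 = c^2 - 3 * b * d" using disc by (simp_all add: s_def)
  have "s^2 < (- c)^2" using s b d by simp
  then have "s < - c" using c by (intro power_less_imp_less_base[of s 2]) auto
  have xm: "b * xm = - c - s" using b by (simp add: x_m_def s_def)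
  have "b * xm > 0" using xm \<open>s < - c\<close> by simp
  then show "xm > 0" using b by (simp add: zero_less_mult_iff)
  show "b * xm < - c" using xm s by simp
  \<comment> \<open>Completing the square; the roots are where b x + c is s or -s.\<close>
  have q: "b * (b * x^2 + 2 * c * x + 3 * d) = (b * x + c)^2 - s^2" for x
    unfolding s(2) by algebra
  have "b * (b * xm^2 + 2 * c * xm + 3 * d) = 0" unfolding q xm by simp
  then show "b * xm^2 + 2 * c * xm + 3 * d = 0" using b by simp
  show "b * x^2 + 2 * c * x + 3 * d > 0" if "0 < x" "x < xm"
  proof -
    have "b * x < b * xm" using that b by simp
    then have "s^2 < (- (b * x + c))^2"
      using xm s by (intro power_strict_mono) auto
    then have "b * (b * x^2 + 2 * c * x + 3 * d) > 0" unfolding q power2_minus by simp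
    then show ?thesis using b by (simp add: zero_less_mult_iff)
  qed
  show "b * x^2 + 2 * c * x + 3 * d < 0"
    if x: "xm < x" "x < y" and y: "b * y^2 + 2 * c * y + 3 * d < 0"
  proof -
    have "b * (b * y^2 + 2 * c * y + 3 * d) < 0" using b y by (simp add: mult_pos_neg)
    then have "(b * y + c)^2 < s^2" unfolding q by simp
    then have "\<bar>b * y + c\<bar> < s" using s abs_less_iff[of "b * y + c" s]
      by (metis abs_of_pos power2_less_imp_less power2_abs less_imp_le)
    moreover have "b * xm < b * x" "b * x < b * y" using x b by simp_all
    ultimately have "\<bar>b * x + c\<bar> < s" using xm by linarith
    then have "\<bar>b * x + c\<bar>^2 < s^2" by (intro power_strict_mono) auto
    then have "b * (b * x^2 + 2 * c * x + 3 * d) < 0" unfolding q by simp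
    then show ?thesis using b by (simp add: mult_less_0_iff)
  qed
qed

lemma f_decreasing:
  assumes "0 < x" "x < y" "y \<le> xm"
  shows "f y < f x"
proof (rule DERIV_neg_imp_decreasing_open[where f = f])
  fix z assume z: "x < z" "z < y"
  have "- (b * z^2 + 2 * c * z + 3 * d) / z^4 < 0"
    using slope_pos[of z] z assms by (simp add: divide_less_0_iff)
  then show "\<exists>D. DERIV f z :> D \<and> D < 0" using DERIV_f[of z] z assms by auto
qed (use assms isCont_f in \<open>auto intro!: continuous_at_imp_continuous_on\<close>)

lemma f_increasing:
  assumes T: "b * T^2 + 2 * c * T + 3 * d < 0" and "xm \<le> x" "x < y" "y \<le> T"
  shows "f x < f y"
proof (rule DERIV_pos_imp_increasing_open[where f = f])
  fix z assume z: "x < z" "z < y"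
  have "- (b * z^2 + 2 * c * z + 3 * d) / z^4 > 0"
    using slope_neg[of z T] z assms xm_pos by (intro divide_pos_pos) auto
  then show "\<exists>D. DERIV f z :> D \<and> D > 0" using DERIV_f[of z] z assms xm_pos by auto
qed (use assms xm_pos isCont_f in \<open>auto intro!: continuous_at_imp_continuous_on\<close>)

lemma xm_less:
  assumes "T > 0" "b * T^2 + 2 * c * T + 3 * d < 0"
  shows "xm < T"
  using assms slope_pos[of T] xm_root by (cases T xm rule: linorder_cases) auto

lemma f_xm_le:
  assumes "b * T^2 + 2 * c * T + 3 * d < 0" "0 < x" "x \<le> T"
  shows "f xm \<le> f x"
  using f_decreasing[of x xm] f_increasing[of T xm x] assms
  by (cases x xm rule: linorder_cases) auto

lemma level_set:
  assumes \<delta>: "0 < \<delta>" "\<delta> < T" and f: "f \<delta> = T" "f T = T" and T: "T \<le> a" and x: "x > 0"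
  shows "f x < T \<longleftrightarrow> \<delta> < x \<and> x < T" and "T < f x \<longleftrightarrow> x < \<delta> \<or> T < x"
proof -
  \<comment> \<open>Forced by the constant term of the factorization, \<delta> T \<kappa> =
    d.\<close>
  define \<kappa> where "\<kappa> = d / (\<delta> * T)"
  define A where "A = a - T"
  have \<kappa>: "\<kappa> > 0" using d \<delta> by (simp add: \<kappa>_def)
  have d_eq: "d = \<delta> * T * \<kappa>" using \<delta> by (simp add: \<kappa>_def)
  have N: "f y = T + (A * y^3 + b * y^2 + c * y + d) / y^3" if "y > 0" for y
    using that by (simp add: phi_def A_def field_simps)
  \<comment> \<open>The remainder y (\<alpha> y + \<beta>) vanishes at the two roots \<delta> and T
    of the cubic, so \<alpha> = \<beta> = 0.\<close>
  define \<alpha> where "\<alpha> = b - (\<kappa> - A * (\<delta> + T))"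
  define \<beta> where "\<beta> = c - (A * \<delta> * T - \<kappa> * (\<delta> + T))"
  have id: "A * y^3 + b * y^2 + c * y + d
      = (y - \<delta>) * (y - T) * (A * y + \<kappa>) + y * (\<alpha> * y + \<beta>)" for y
    unfolding \<alpha>_def \<beta>_def d_eq by algebra
  have "\<alpha> * \<delta> + \<beta> = 0" "\<alpha> * T + \<beta> = 0"
    using N[of \<delta>] N[of T] id[of \<delta>] id[of T] f \<delta> by auto
  then have "\<alpha> * (T - \<delta>) = 0" by algebra
  then have "\<alpha> = 0" using \<delta> by simp
  then have "\<beta> = 0" using \<open>\<alpha> * \<delta> + \<beta> = 0\<close> by simp
  have "A * x + \<kappa> > 0" using T x \<kappa> by (simp add: A_def add_nonneg_pos)
  then obtain k where k: "k = (A * x + \<kappa>) / x^3" and pos: "k > 0" using x by simp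
  have eq: "f x = T + (x - \<delta>) * (x - T) * k"
    using N[OF x] id[of x] \<open>\<alpha> = 0\<close> \<open>\<beta> = 0\<close> by (simp add: k)
  show "f x < T \<longleftrightarrow> \<delta> < x \<and> x < T"
    unfolding eq using pos \<delta> by (auto simp: mult_less_0_iff zero_less_mult_iff)
  show "T < f x \<longleftrightarrow> x < \<delta> \<or> T < x"
    unfolding eq using pos \<delta> by (auto simp: mult_less_0_iff zero_less_mult_iff)
qed

section \<open>Convergence to an equilibrium\<close>

lemma orbit_outside_tendsto_t2:
  assumes sol: "positive_solution f t" and \<delta>: "0 < \<delta>" "\<delta> < t2" "f \<delta> = t2" and le: "t2 \<le> a"
    and out: "t 0 \<notin> {\<delta><..<t2}"
  shows "t \<longlonglongrightarrow> t2"
\<comment> \<open>One step puts the orbit at or above \<open>t2\<close>; from there on it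
  decreases.\<close>
proof (rule LIMSEQ_imp_Suc, rule decreasing_orbit_tendsto[where g = f and y = "\<lambda>n. t (Suc n)"])
  have t: "t 0 > 0" "\<And>n. t (Suc n) = f (t n)" using sol by (auto simp: positive_solution_def)
  note level = level_set[OF \<delta> f_t2 le]
  show "t2 \<le> t (Suc 0)" using level(1)[of "t 0"] t out by auto
  show "t2 \<le> f x \<and> f x < x" if "t2 < x" for x
    using level(2)[of x] f_less_iff[of x] P_right[OF that] that t1 t12 by auto
  show "isCont f x" if "t2 \<le> x" for x using isCont_f that t1 t12 by auto
qed (use sol f_t2 in \<open>auto simp: positive_solution_def\<close>)

lemma orbit_inside_tendsto_t1:
  assumes sol: "positive_solution f t" and \<delta>: "0 < \<delta>" "\<delta> < t1" "f \<delta> = t1" and le: "t1 \<le> a"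
    and t0: "t 0 \<in> {\<delta>..t1}"
  shows "t \<longlonglongrightarrow> t1"
proof (rule increasing_orbit_tendsto[where g = f and y = t and z = t1])
  show "x < f x \<and> f x \<le> t1" if "t 0 \<le> x" "x < t1" for x
  proof -
    have "\<delta> \<le> x" using that t0 by simp
    then have "\<not> t1 < f x" using level_set(2)[OF \<delta> f_t1 le, of x] that \<delta> by simp
    then show ?thesis using f_greater_iff[of x] P_left[of x] that \<delta> \<open>\<delta> \<le> x\<close> by simp
  qed
  show "isCont f x" if "t 0 \<le> x" for x using isCont_f[of x] that \<delta> t0 by simp
qed (use sol f_t1 t0 in \<open>auto simp: positive_solution_def\<close>)

text \<open>x f(x) = a x + b + c/x + d/x^2 has derivative (a x^3 - c x - 2 d) / x^3. Its numerator
  increases for x > 0 because c < 0, and at the double root \<open>t1\<close> it equals 2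
  t1^4.\<close>

lemma mult_f_strict_mono:
  assumes D: "Pderiv a b c t1 = 0" and xy: "t1 \<le> x" "x < y"
  shows "x * f x < y * f y"
proof -
  have pos: "x > 0" "y > 0" using xy t1 by auto
  have "P t1 = 0" using roots t1 by simp
  moreover have "a * t1^3 - c * t1 - 2 * d = 2 * t1^4 - t1 * Pderiv a b c t1 + 2 * P t1"
    unfolding Ppoly_def Pderiv_def by algebra
  ultimately have "a * t1^3 - c * t1 - 2 * d = 2 * t1^4" using D by simp
  then have key: "2 * d < a * t1^3 - c * t1" using zero_less_power[OF t1, of 4] by linarith
  have bound: "2 * d < a * (u * v^2) - c * v" if "t1 \<le> u" "t1 \<le> v" for u v
  proof -
    have "t1 * t1^2 \<le> u * v^2" using that t1 by (intro mult_mono power_mono) auto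
    then have "a * t1^3 \<le> a * (u * v^2)" using a by (simp add: eval_nat_numeral)
    moreover have "- c * t1 \<le> - c * v" using that c by (intro mult_left_mono) auto
    ultimately show ?thesis using key by simp
  qed
  \<comment> \<open>Adding the two bounds gives a positive difference quotient of x f(x), cleared of
    the denominator x^2 y^2.\<close>
  have "x * (2 * d) < x * (a * (x * y^2) - c * y)" "y * (2 * d) < y * (a * (y * x^2) - c * x)"
    using bound[of x y] bound[of y x] xy pos by (intro mult_strict_left_mono; simp)+
  then have "a * (x^2 * y^2) - c * (x * y) - d * (x + y) > 0"
    by (simp add: algebra_simps power2_eq_square)
  then have "(y - x) * ((a * (x^2 * y^2) - c * (x * y) - d * (x + y)) / (x^2 * y^2)) > 0"
    using xy pos by (intro mult_pos_pos divide_pos_pos) auto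
  also have "\<dots> = y * f y - x * f x"
    using pos by (simp add: phi_def field_simps eval_nat_numeral)
  finally show ?thesis by simp
qed

text \<open>Since \<open>x * f x\<close> increases on \<open>[t1, \<infinity>)\<close>, the point \<open>f x\<close> lies strictly between \<open>x\<close> and
  \<open>t2\<^sup>2 / x\<close>, so \<open>\<bar>ln x - ln t2\<bar>\<close> is a Lyapunov function there.\<close>

lemma orbit_outside_double_t1_tendsto_t2:
  assumes sol: "positive_solution f t" and neg: "\<And>x. t1 < x \<Longrightarrow> x < t2 \<Longrightarrow> P x < 0"
    and \<delta>: "0 < \<delta>" "\<delta> < t1" "f \<delta> = t1" and le: "t1 \<le> a" and out: "t 0 \<notin> {\<delta>..t1}"
  shows "t \<longlonglongrightarrow> t2"
proof -
  define y where "y n = t (Suc n)" for n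
  define V where "V x = \<bar>ln x - ln t2\<bar>" for x
  have t: "t 0 > 0" "\<And>n. t (Suc n) = f (t n)" using sol by (auto simp: positive_solution_def)
  have step: "y (Suc n) = f (y n)" for n by (simp add: y_def t)
  note level = level_set(2)[OF \<delta> f_t1 le]
  have y0: "y 0 > t1" using level[of "t 0"] t out by (auto simp: y_def)
  have D: "Pderiv a b c t1 = 0" using neg by (rule double_root_t1)
  have t2: "t2 > 0" using t1 t12 by simp
  have less: "V (f x) < V x" if "t1 < x" "x \<noteq> t2" for x
  proof -
    have x: "x > 0" "f x > 0" using that t1 f_pos by auto
    have sq: "ln (t2 * t2) = ln t2 + ln t2" "ln (x * f x) = ln x + ln (f x)"
      using x t2 by (simp_all add: ln_mult)
    show ?thesis
    proof (cases "x < t2")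
      case True
      then have "x < f x" using f_greater_iff[of x] neg that x by simp
      then have "ln x < ln (f x)" using x by simp
      moreover have "x * f x < t2 * t2" using mult_f_strict_mono[OF D, of x t2] True that f_t2 by simp
      then have "ln (x * f x) < ln (t2 * t2)" using x t2 by simp
      ultimately show ?thesis unfolding V_def using sq by linarith
    next
      case False
      then have "f x < x" using f_less_iff[of x] P_right[of x] that x by simp
      then have "ln (f x) < ln x" using x by simp
      moreover have "t2 * t2 < x * f x"
        using mult_f_strict_mono[OF D, of t2 x] False that t12 f_t2 by simp
      then have "ln (t2 * t2) < ln (x * f x)" using x t2 by simp
      ultimately show ?thesis unfolding V_def using sq by linarith
    qed
  qed
  \<comment> \<open>Upper end of the sublevel set of \<open>V\<close> that contains the
    orbit.\<close>
  define U where "U = exp (ln t2 + V (y 0))"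
  have U: "x \<le> U" if "x > 0" "V x \<le> V (y 0)" for x
  proof -
    have "ln x \<le> ln t2 + V (y 0)" using that by (simp add: V_def)
    then have "exp (ln x) \<le> U" unfolding U_def by simp
    then show ?thesis using that by simp
  qed
  have "t2 \<le> U" using t2 by (intro U) (auto simp: V_def)
  moreover have "continuous_on {t2..U} f"
    using t2 isCont_f by (auto intro!: continuous_at_imp_continuous_on)
  ultimately obtain w where w: "t2 \<le> w" and min: "\<And>x. t2 \<le> x \<Longrightarrow> x \<le> U \<Longrightarrow> f w \<le> f x"
    using continuous_attains_inf[of "{t2..U}" f] by auto
  have fw: "t1 < f w" using level[of w] w t2 t12 by simp
  \<comment> \<open>The orbit must stay away from the other fixed point \<open>t1\<close>. Points
    below \<open>t2\<close> move up, and points of [t2, U] are not sent below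
    \<open>f w > t1\<close>.\<close>
  define l where "l = min (y 0) (f w)"
  have l: "t1 < l" using y0 fw by (simp add: l_def)
  have inv: "l \<le> y n \<and> V (y n) \<le> V (y 0)" for n
  proof (induction n)
    case (Suc n)
    then have yn: "t1 < y n" "y n \<le> U" using l U[of "y n"] t1 by auto
    have "V (f (y n)) \<le> V (y n)" using less[of "y n"] yn f_t2 by (cases "y n = t2") auto
    moreover have "l \<le> f (y n)"
    proof (cases "y n < t2")
      case True
      then show ?thesis using f_greater_iff[of "y n"] neg[of "y n"] yn t1 Suc by auto
    next
      case False
      then show ?thesis using min[of "y n"] yn by (auto simp: l_def)
    qed
    ultimately show ?case using Suc step by auto
  qed (simp add: l_def)
  have "(\<lambda>n. V (y n)) \<longlonglongrightarrow> V t2"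
  proof (rule lyapunov_tendsto[where g = f and y = y and l = l and u = U])
    show "l \<le> y n \<and> y n \<le> U" for n using inv[of n] U[of "y n"] l t1 by auto
    show "isCont f x \<and> isCont V x" if "l \<le> x" for x
      using that l t1 isCont_f unfolding V_def by (auto intro!: continuous_intros)
  qed (use step less l f_t2 in \<open>auto simp: V_def\<close>)
  then have "(\<lambda>n. ln (y n) - ln t2) \<longlonglongrightarrow> 0"
    by (simp add: V_def tendsto_rabs_zero_iff)
  then have "(\<lambda>n. ln (y n)) \<longlonglongrightarrow> ln t2" by (simp add: LIM_zero_iff)
  then have "(\<lambda>n. exp (ln (y n))) \<longlonglongrightarrow> exp (ln t2)" by (rule tendsto_exp)
  moreover have "y n > 0" for n using inv[of n] l t1 by auto
  ultimately have "y \<longlonglongrightarrow> t2" using t2 by simp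
  then show ?thesis unfolding y_def by (rule LIMSEQ_imp_Suc)
qed

text \<open>After one step the orbit lies in [xm, t2), where \<open>f\<close> increases and
  \<open>t1\<close> separates the points moving up from those moving down.\<close>

lemma orbit_tendsto_t1_of_xm_le:
  assumes sol: "positive_solution f t" and pos: "\<And>x. t1 < x \<Longrightarrow> x < t2 \<Longrightarrow> P x > 0"
    and T: "b * t2^2 + 2 * c * t2 + 3 * d < 0"
    and \<delta>: "0 < \<delta>" "\<delta> < t2" "f \<delta> = t2" and le: "t2 \<le> a"
    and xm: "xm \<le> t1" and t0: "t 0 \<in> {\<delta><..<t2}"
  shows "t \<longlonglongrightarrow> t1"
proof -
  define y where "y n = t (Suc n)" for n
  have t: "t 0 > 0" "\<And>n. t (Suc n) = f (t n)" using sol by (auto simp: positive_solution_def)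
  have step: "y (Suc n) = f (y n)" for n by (simp add: y_def t)
  have "xm \<le> f xm"
    using f_less_iff[OF xm_pos] f_eq_iff[OF xm_pos] P_left[OF xm_pos] xm by force
  also have "f xm \<le> f (t 0)" using f_xm_le[OF T t(1)] t0 by simp
  finally have low: "xm \<le> y 0" by (simp add: y_def t)
  have high: "y 0 < t2" using level_set(1)[OF \<delta> f_t2 le t(1)] t0 by (simp add: y_def t)
  have "y \<longlonglongrightarrow> t1"
  proof (cases "t1 \<le> y 0")
    case True
    show ?thesis
    proof (rule decreasing_orbit_tendsto[where g = f and y = y and z = t1])
      show "t1 \<le> f x \<and> f x < x" if "t1 < x" "x \<le> y 0" for x
        using f_increasing[OF T xm, of x] f_less_iff[of x] pos[of x] that high t1 f_t1 by simp
      show "isCont f x" if "t1 \<le> x" for x using isCont_f[of x] that t1 by simp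
    qed (use step f_t1 True in auto)
  next
    case False
    show ?thesis
    proof (rule increasing_orbit_tendsto[where g = f and y = y and z = t1])
      show "x < f x \<and> f x \<le> t1" if "y 0 \<le> x" "x < t1" for x
        using f_increasing[OF T, of x t1] f_greater_iff[of x] P_left[of x] that low xm_pos t12 f_t1
        by simp
      show "isCont f x" if "y 0 \<le> x" for x using isCont_f[of x] that low xm_pos by simp
    qed (use step f_t1 False in auto)
  qed
  then show ?thesis unfolding y_def by (rule LIMSEQ_imp_Suc)
qed

section \<open>Multipliers of 2-cycles and attraction to them\<close>

text \<open>On the monotone branch \<open>(0, xm]\<close> the map has negative Schwarzian derivative, since it is a
  cubic polynomial with real critical points in \<open>1/x\<close>. Hence \<open>f'(p) f'(q)\<close> is less than the
  squared slope of the chord over \<open>[p, q]\<close>, which is \<open>1\<close> for a 2-cycle.\<close>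

lemma two_cycle_multiplier_less_1:
  assumes pq: "0 < p" "p < q" "q \<le> xm" and cyc: "f p = q" "f q = p"
  shows "(b * p^2 + 2 * c * p + 3 * d) * (b * q^2 + 2 * c * q + 3 * d) < p^4 * q^4"
proof -
  define W where "W x = b * x^2 + 2 * c * x + 3 * d" for x
  \<comment> \<open>E / (p^3 q^3) is (f p - f q) / (q - p), which is 1 for a 2-cycle.\<close>
  define E where "E = b * p^2 * q^2 + c * (p * q) * (p + q) + d * (p^2 + p * q + q^2)"
  define A B where "A = (3 * d + c * p) / 3" and "B = (3 * d + c * q) / 3"
  define K where "K = (c^2 / 3 - b * d) * (p^2 * q^2) + (A * q + B * p)^2 + 2 * A * B * (p * q)"
  have q: "q > 0" using pq by simp
  \<comment> \<open>With the equation for \<open>xm\<close> this gives c xm + 3 d > 0; since c < 0,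
    the same holds at \<open>p\<close> and \<open>q\<close>.\<close>
  have "b * xm^2 + c * xm = xm * (b * xm + c)" by algebra
  also have "\<dots> < 0" using xm_pos xm_upper by (simp add: mult_pos_neg)
  finally have xm: "c * xm + 3 * d > 0" using xm_root by linarith
  have "c * xm \<le> c * p" "c * xm \<le> c * q" using pq c by (auto intro!: mult_left_mono_neg)
  then have AB: "A \<ge> 0" "B \<ge> 0" unfolding A_def B_def using xm by simp_all
  have "c^2 / 3 - b * d > 0" using disc by simp
  then have "(c^2 / 3 - b * d) * (p^2 * q^2) > 0" using pq q by simp
  moreover have "2 * A * B * (p * q) \<ge> 0" using AB pq q by simp
  ultimately have K: "K > 0"
    unfolding K_def using zero_le_power2[of "A * q + B * p"] by linarith
  have num: "a * p^3 + b * p^2 + c * p + d = q * p^3" "a * q^3 + b * q^2 + c * q + d = p * q^3"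
    using cyc pq q by (simp_all add: phi_def divide_eq_eq)
  have "(q - p) * (E - p^3 * q^3)
      = q^3 * (a * p^3 + b * p^2 + c * p + d - q * p^3)
        - p^3 * (a * q^3 + b * q^2 + c * q + d - p * q^3)"
    unfolding E_def by algebra
  then have E: "E = p^3 * q^3" using num pq by simp
  \<comment> \<open>After division by 9 p^6 q^6 the left side is the squared chord slope minus f'(p)
    f'(q).\<close>
  have "9 * (E^2 - p^2 * q^2 * (W p * W q)) = (q - p)^2 * (9 * K)"
    unfolding E_def W_def K_def A_def B_def by (simp add: field_simps) algebra
  moreover have "(q - p)^2 * (9 * K) > 0" using K pq by simp
  ultimately have "9 * (E^2 - p^2 * q^2 * (W p * W q)) > 0" by (simp only:)
  then have "p^2 * q^2 * (W p * W q) < E^2" by simp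
  also have "E^2 = p^2 * q^2 * (p^4 * q^4)" unfolding E by algebra
  finally show ?thesis using pq q unfolding W_def by simp
qed

text \<open>The derivative of f o f at \<open>q\<close> is the multiplier, which is below 1, so x -
  f(f x) increases through its zero \<open>q\<close>.\<close>

lemma two_cycle_attracts_from_left:
  assumes pq: "0 < p" "p < q" "q \<le> xm" and cyc: "f p = q" "f q = p"
  shows "\<exists>e>0. \<forall>h>0. h < e \<longrightarrow> q - h < f (f (q - h))"
proof -
  define W where "W x = b * x^2 + 2 * c * x + 3 * d" for x
  define D where "D = (- W p / p^4) * (- W q / q^4)"
  have q: "q > 0" using pq by simp
  have "DERIV (\<lambda>x. f (f x)) q :> D"
    unfolding D_def W_def using DERIV_f[OF pq(1)] cyc by (intro DERIV_chain2[OF _ DERIV_f[OF q]]) simp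
  then have "DERIV (\<lambda>x. x - f (f x)) q :> 1 - D"
    by (intro DERIV_diff DERIV_ident)
  moreover have "D = W p * W q / (p^4 * q^4)" by (simp add: D_def)
  then have "1 - D > 0"
    using two_cycle_multiplier_less_1[OF assms] pq q by (simp add: W_def)
  ultimately obtain e where "e > 0"
    "\<And>h. h > 0 \<Longrightarrow> h < e \<Longrightarrow> (q - h) - f (f (q - h)) < q - f (f q)"
    using DERIV_pos_inc_left by blast
  then show ?thesis using cyc by (intro exI[of _ e]) auto
qed

text \<open>Serves both subcases with \<open>t1 < xm\<close>: \<open>z = t1\<close> without
  2-cycles, and \<open>z = q\<close> for a cycle (p, q).\<close>

lemma orbit_converges_to_2cycle:
  assumes sol: "positive_solution f t" and pos: "\<And>x. t1 < x \<Longrightarrow> x < t2 \<Longrightarrow> P x > 0"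
    and T: "b * t2^2 + 2 * c * t2 + 3 * d < 0"
    and \<delta>: "0 < \<delta>" "\<delta> < t2" "f \<delta> = t2" and le: "t2 \<le> a" and xm: "t1 < xm"
    and z: "t1 \<le> z" "z \<le> xm" "f (f z) = z"
    and no_cycle: "\<And>x. z < x \<Longrightarrow> x < t2 \<Longrightarrow> f (f x) \<noteq> x"
    and up: "\<And>x. t1 < x \<Longrightarrow> x < z \<Longrightarrow> x < f (f x)"
  shows "f (f xm) \<le> xm"
    and "t 0 \<in> {f xm..xm} \<Longrightarrow> t 0 \<noteq> t1 \<Longrightarrow> converges_to_2cycle t z (f z)"
    and "t 0 \<in> {\<delta><..<t2} \<Longrightarrow> (\<And>n. t n \<noteq> t1) \<Longrightarrow> converges_to_2cycle t z (f z)"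
proof -
  have t: "t 0 > 0" "\<And>n. t (Suc n) = f (t n)" using sol by (auto simp: positive_solution_def)
  have t2: "xm < t2" using xm_less T t1 t12 by simp
  have z0: "z > 0" using z t1 by simp
  have f_xm: "f xm < xm" using f_less_iff[OF xm_pos] pos[OF xm t2] by simp
  \<comment> \<open>A preimage \<open>w\<close> of \<open>xm\<close> in (xm, t2) is a sample point
    for the sign of x - f(f x) on (z, t2): f(f w) = f xm < xm < w.\<close>
  have "\<forall>x. xm \<le> x \<and> x \<le> t2 \<longrightarrow> isCont f x" using isCont_f xm_pos by simp
  then obtain w where w: "xm \<le> w" "w \<le> t2" "f w = xm"
    using IVT[of f xm xm t2] f_xm f_t2 t2 by auto
  have "w \<noteq> xm" "w \<noteq> t2" using w f_xm f_t2 t2 by auto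
  then have w': "xm < w" "w < t2" using w by simp_all
  have down: "f (f x) < x" if "z < x" "x < t2" for x
  proof -
    have "w - f (f w) > 0" using w w' f_xm by simp
    moreover have "isCont (\<lambda>x. x - f (f x)) x" if "z < x" for x
      using isCont_ff[of x] that z0 by (intro continuous_intros) auto
    ultimately have "x - f (f x) > 0"
      using isCont_same_sign[of z t2 "\<lambda>x. x - f (f x)" w x] no_cycle that w' z by force
    then show ?thesis by simp
  qed
  show ff_xm: "f (f xm) \<le> xm" using down[of xm] z t2 by (cases "z = xm") auto
  have f_xm_gt: "\<delta> < f xm"
    using level_set(1)[OF \<delta> f_t2 le f_pos[OF xm_pos]] ff_xm t2 by simp
  have right: "converges_to_2cycle y z (f z)"
    if step: "\<And>n. y (Suc n) = f (y n)" and y0: "t1 < y 0" "y 0 \<le> xm" for y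
  proof -
    \<comment> \<open>\<open>f\<close> maps [t1, xm] below \<open>t1\<close>, again into its
      decreasing branch, so f o f increases on [t1, xm].\<close>
    have small: "f x \<le> t1" if "t1 \<le> x" "x \<le> xm" for x
      using f_decreasing[of t1 x] that f_t1 t1 by (cases "x = t1") auto
    have mono: "f (f x) < f (f x')" if "t1 \<le> x" "x < x'" "x' \<le> xm" for x x'
      using f_decreasing[of x x'] f_decreasing[of "f x'" "f x"] small[of x] that t1 xm f_pos[of x']
      by simp
    have even: "(\<lambda>n. y (2 * n)) \<longlonglongrightarrow> z"
    proof (cases "z \<le> y 0")
      case True
      show ?thesis
      proof (rule decreasing_orbit_tendsto[where g = "\<lambda>x. f (f x)" and y = "\<lambda>n. y (2 * n)"])
        show "z \<le> f (f x) \<and> f (f x) < x" if "z < x" "x \<le> y (2 * 0)" for x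
          using mono[of z x] down[of x] that y0 z t2 by simp
        show "isCont (\<lambda>x. f (f x)) x" if "z \<le> x" for x using isCont_ff[of x] that z0 by simp
      qed (use step True z in auto)
    next
      case False
      show ?thesis
      proof (rule increasing_orbit_tendsto[where g = "\<lambda>x. f (f x)" and y = "\<lambda>n. y (2 * n)"])
        show "x < f (f x) \<and> f (f x) \<le> z" if "y (2 * 0) \<le> x" "x < z" for x
          using mono[of x z] up[of x] that y0 z by simp
        show "isCont (\<lambda>x. f (f x)) x" if "y (2 * 0) \<le> x" for x
          using isCont_ff[of x] that y0 t1 by simp
      qed (use step False z in auto)
    qed
    moreover have "(\<lambda>n. y (2 * n + 1)) \<longlonglongrightarrow> f z"
      using isCont_tendsto_compose[OF isCont_f[OF z0] even] by (simp add: step)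
    ultimately show ?thesis by (simp add: converges_to_2cycle_def)
  qed
  have core: "converges_to_2cycle y z (f z)"
    if step: "\<And>n. y (Suc n) = f (y n)" and y0: "y 0 \<in> {f xm..xm}" "y 0 \<noteq> t1" for y
  proof (cases "t1 < y 0")
    case True
    then show ?thesis using right[where y = y, OF step] y0 by simp
  next
    \<comment> \<open>One step moves a point of [f xm, t1) into (t1, xm].\<close>
    case False
    have pos0: "f xm > 0" using f_pos xm_pos by blast
    then have "f (y 0) > t1" using f_decreasing[of "y 0" t1] False y0 xm f_t1 by simp
    moreover have "f (y 0) \<le> f (f xm)"
      using f_decreasing[of "f xm" "y 0"] pos0 y0 by (cases "f xm = y 0") auto
    ultimately have "converges_to_2cycle (\<lambda>n. y (n + 1)) z (f z)"
      using ff_xm by (intro right) (simp_all add: step)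
    then show ?thesis by (rule converges_to_2cycle_offset)
  qed
  show "t 0 \<in> {f xm..xm} \<Longrightarrow> t 0 \<noteq> t1 \<Longrightarrow> converges_to_2cycle t z (f z)"
    using core[of t] t by simp
  assume t0: "t 0 \<in> {\<delta><..<t2}" and ne: "\<And>n. t n \<noteq> t1"
  have in_range: "t n \<in> {\<delta><..<t2} \<and> f xm \<le> t (Suc n)" for n
  proof (induction n)
    case 0
    then show ?case using t0 f_xm_le[OF T t(1)] t by simp
  next
    case (Suc n)
    then have tn: "t n > 0" "t (Suc n) > 0" using \<delta> f_xm_gt by auto
    have "t (Suc n) < t2" using level_set(1)[OF \<delta> f_t2 le tn(1)] Suc t by simp
    moreover have "f xm \<le> f (t (Suc n))" using f_xm_le[OF T tn(2)] calculation by simp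
    ultimately show ?case using Suc f_xm_gt t by simp
  qed
  \<comment> \<open>Otherwise the orbit would decrease to a fixed point strictly between
    \<open>t1\<close> and \<open>t2\<close>. The index \<open>Suc k\<close> makes the lower bound
    \<open>f xm\<close> available.\<close>
  have "\<exists>k. t (Suc k) \<le> xm"
  proof (rule ccontr)
    assume "\<not> ?thesis"
    then have gt: "xm < t (Suc n)" for n by (simp add: not_le)
    define y where "y n = t (Suc n)" for n
    have step: "y (Suc n) = f (y n)" for n by (simp add: y_def t)
    have y: "xm < y n" "y n < t2" for n using gt in_range[of "Suc n"] by (auto simp: y_def)
    have dec: "decseq y"
    proof (rule decseq_SucI)
      show "y (Suc n) \<le> y n" for n
        using f_less_iff[of "y n"] pos[of "y n"] y[of n] xm t1 by (simp add: step)
    qed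
    have low: "\<forall>n. xm \<le> y n" using y(1) by (simp add: less_imp_le)
    then obtain L where L: "y \<longlonglongrightarrow> L"
      using decseq_convergent[OF dec, of xm] by blast
    have "xm \<le> L" using L low by (meson LIMSEQ_le_const)
    moreover have "L \<le> y 0" using decseq_ge[OF dec L] .
    ultimately have L': "t1 < L" "L < t2" "L > 0" using xm y[of 0] xm_pos by auto
    have "f L = L" by (rule orbit_limit_fixed[where y = y, OF step L isCont_f[OF L'(3)]])
    then show False using f_eq_iff L' by simp
  qed
  then obtain k where "t (Suc k) \<le> xm" by blast
  then have "converges_to_2cycle (\<lambda>n. t (n + Suc k)) z (f z)"
    using in_range[of k] ne[of "Suc k"] by (intro core) (simp_all add: t)
  then show "converges_to_2cycle t z (f z)" by (rule converges_to_2cycle_offset)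
qed

end

section \<open>Combination of the cases\<close>

theorem theorem7:
  fixes a b c d t1 t2 :: real and t :: "nat \<Rightarrow> real"
  assumes a: "a > 0" and b: "b > 0" and d: "d > 0"
    and cb: "c_b a b < (b^2 - 12*d) / (3*a)"
    and c_lo: "c_minus a b d < c" and c_hi: "c < c_star b d"
    and eq: "{x. x > 0 \<and> phi a b c d x = x} = {t1, t2}" and t12: "t1 < t2"
    and sol: "positive_solution (phi a b c d) t"
  shows
   "(c = c_m a b d \<and> t2 \<le> a \<longrightarrow>
      (\<forall>\<delta>. 0 < \<delta> \<and> \<delta> < x_m b c d \<and> phi a b c d \<delta> = t2 \<longrightarrow>
        ( (x_m b c d \<le> t1 \<longrightarrow>
              (t 0 \<in> {\<delta><..<t2} \<longrightarrow> t \<longlonglongrightarrow> t1) \<and>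
              (t 0 \<notin> {\<delta><..<t2} \<longrightarrow> t \<longlonglongrightarrow> t2))
        \<and> (t1 < x_m b c d \<longrightarrow>
              ( (\<not> (\<exists>p q. is_2cycle (phi a b c d) p q) \<longrightarrow>
                   (t 0 \<in> {\<delta><..<t2} \<longrightarrow> t \<longlonglongrightarrow> t1) \<and>
                   (t 0 \<notin> {\<delta><..<t2} \<longrightarrow> t \<longlonglongrightarrow> t2))
              \<and> (\<forall>p q. is_2cycle (phi a b c d) p q \<and> p < t1 \<and> t1 < q \<and> q \<le> x_m b c d
                     \<and> (\<forall>p' q'. is_2cycle (phi a b c d) p' q' \<longrightarrow> {p', q'} = {p, q}) \<longrightarrow>
                   (let S = {s. s > 0 \<and> (\<exists>n. (phi a b c d ^^ n) s = t1)};
                        I = {phi a b c d (x_m b c d) .. (phi a b c d ^^ 2) (x_m b c d)}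
                    in (t 0 \<in> {\<delta><..<t2} - S \<longrightarrow> converges_to_2cycle t p q) \<and>
                       (t 0 \<in> S \<longrightarrow> t \<longlonglongrightarrow> t1) \<and>
                       (t 0 \<notin> {\<delta><..<t2} \<and> t 0 \<notin> S \<longrightarrow> t \<longlonglongrightarrow> t2) \<and>
                       (t 0 \<in> I - {t1} \<longrightarrow> converges_to_2cycle t p q))))))))
    \<and>
    (c = c_M a b d \<and> t1 \<le> a \<longrightarrow>
      (\<forall>\<delta>'. 0 < \<delta>' \<and> \<delta>' < x_m b c d \<and> phi a b c d \<delta>' = t1 \<longrightarrow>
         (t 0 \<in> {\<delta>'..t1} \<longrightarrow> t \<longlonglongrightarrow> t1) \<and>
         (t 0 \<notin> {\<delta>'..t1} \<longrightarrow> t \<longlonglongrightarrow> t2)))"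
proof -
  let ?f = "phi a b c d" and ?xm = "x_m b c d"
  have c: "sqrt (3 * b * d) < - c" using c_hi by (simp add: c_star_def)
  have sq: "sqrt (3 * b * d) \<ge> 0" using b d by simp
  have c0: "c < 0" using c sq by linarith
  have "(sqrt (3 * b * d))^2 < (- c)^2" using c sq by (intro power_strict_mono) auto
  then have disc: "3 * b * d < c^2" using b d by simp
  have phi_eq: "?f x = x \<longleftrightarrow> Ppoly a b c d x = 0" if "x > 0" for x
    using that by (simp add: phi_def Ppoly_def divide_eq_eq) (auto simp: algebra_simps eval_nat_numeral)
  have fixed: "x > 0 \<and> ?f x = x \<longleftrightarrow> x = t1 \<or> x = t2" for x using eq by blast
  interpret cubic_quotient_map a b c d t1 t2
  proof
    show "Ppoly a b c d x = 0 \<longleftrightarrow> x = t1 \<or> x = t2" if "x > 0" for x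
      using fixed phi_eq that by blast
    show "0 < t1" using fixed by blast
    show "a * x^3 + b * x^2 + c * x + d > 0" if "x > 0" for x
      using cubic_pos_of_Qpoly_pos[OF a d Qpoly_pos[OF a b d c_lo c0] that] .
  qed (use a b d c0 t12 disc in auto)
  have t: "t 0 > 0" "\<And>n. t (Suc n) = f (t n)" using sol by (auto simp: positive_solution_def)
  have t_iter: "t n = (f ^^ n) (t 0)" for n by (induction n) (simp_all add: t)
  have hit: "t \<longlonglongrightarrow> t1" if "t n = t1" for n
  proof -
    have "t (k + n) = t1" for k by (induction k) (simp_all add: that t f_t1)
    then have "(\<lambda>k. t (k + n)) \<longlonglongrightarrow> t1" by simp
    then show ?thesis by (rule LIMSEQ_offset)
  qed
  have part_b: "(t 0 \<in> {\<delta>..t1} \<longrightarrow> t \<longlonglongrightarrow> t1) \<and> (t 0 \<notin> {\<delta>..t1} \<longrightarrow> t \<longlonglongrightarrow> t2)"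
    if cM: "c = c_M a b d" and le: "t1 \<le> a" and \<delta>: "0 < \<delta>" "\<delta> < ?xm" "?f \<delta> = t1" for \<delta>
  proof -
    \<comment> \<open>A positive sign between the equilibria would give c < c_M.\<close>
    have neg: "\<And>x. t1 < x \<Longrightarrow> x < t2 \<Longrightarrow> P x < 0"
      using P_between P_pos_extremum cM by (metis less_irrefl)
    have "b * t1^2 + 2 * c * t1 + 3 * d = - (t1^4)"
      using roots t1 by (intro double_root_derivative double_root_t1 neg) auto
    then have "?xm < t1" using t1 by (intro xm_less) auto
    then have "\<delta> < t1" using \<delta> by simp
    then show ?thesis
      using orbit_inside_tendsto_t1[OF sol \<delta>(1) _ \<delta>(3) le]
        orbit_outside_double_t1_tendsto_t2[OF sol neg \<delta>(1) _ \<delta>(3) le] by blast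
  qed
  define U where "U p q \<longleftrightarrow> is_2cycle ?f p q \<and> p < t1 \<and> t1 < q \<and> q \<le> ?xm
      \<and> (\<forall>p' q'. is_2cycle ?f p' q' \<longrightarrow> {p', q'} = {p, q})" for p q
  have part_a: "(?xm \<le> t1 \<longrightarrow> t 0 \<in> {\<delta><..<t2} \<longrightarrow> t \<longlonglongrightarrow> t1)
      \<and> (t 0 \<notin> {\<delta><..<t2} \<longrightarrow> t \<longlonglongrightarrow> t2)
      \<and> (t1 < ?xm \<longrightarrow> \<not> (\<exists>p q. is_2cycle ?f p q) \<longrightarrow> t 0 \<in> {\<delta><..<t2} \<longrightarrow> t \<longlonglongrightarrow> t1)
      \<and> (\<forall>p q. t1 < ?xm \<longrightarrow> U p q
          \<longrightarrow> (t 0 \<in> {\<delta><..<t2} \<and> (\<forall>n. t n \<noteq> t1) \<longrightarrow> converges_to_2cycle t p q)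
            \<and> (t 0 \<in> {?f ?xm..?f (?f ?xm)} - {t1} \<longrightarrow> converges_to_2cycle t p q))"
    if cm: "c = c_m a b d" and le: "t2 \<le> a" and \<delta>: "0 < \<delta>" "\<delta> < ?xm" "?f \<delta> = t2" for \<delta>
  proof -
    have pos: "\<And>x. t1 < x \<Longrightarrow> x < t2 \<Longrightarrow> P x > 0"
      using P_between P_neg_extremum cm by (metis less_irrefl)
    have "b * t2^2 + 2 * c * t2 + 3 * d = - (t2^4)"
      using roots t1 t12 by (intro double_root_derivative double_root_t2 pos) auto
    then have T: "b * t2^2 + 2 * c * t2 + 3 * d < 0" using t1 t12 by simp
    then have xm_t2: "?xm < t2" using t1 t12 by (intro xm_less) auto
    then have \<delta>_t2: "\<delta> < t2" using \<delta> by simp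
    note cyc_conv = orbit_converges_to_2cycle[OF sol pos T \<delta>(1) \<delta>_t2 \<delta>(3) le]
    \<comment> \<open>\<open>f\<close> has no fixed point strictly between \<open>t1\<close> and
      \<open>t2\<close>, so every fixed point of f o f there is a genuine cycle point.\<close>
    have is_cycle: "is_2cycle ?f x (?f x)" if "t1 < x" "x < t2" "?f (?f x) = x" for x
      using that t1 f_pos[of x] f_eq_iff[of x] by (auto simp: is_2cycle_def)
    have a21: "t \<longlonglongrightarrow> t1"
      if xm: "t1 < ?xm" and none: "\<not> (\<exists>p q. is_2cycle ?f p q)" and t0: "t 0 \<in> {\<delta><..<t2}"
    proof (cases "\<exists>n. t n = t1")
      case True
      then show ?thesis using hit by blast
    next
      case False
      have "converges_to_2cycle t t1 (?f t1)"
        by (rule cyc_conv(3)) (use xm t0 False is_cycle none f_t1 in auto)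
      then show ?thesis using converges_to_2cycle_refl f_t1 by simp
    qed
    have a22: "(t 0 \<in> {\<delta><..<t2} \<and> (\<forall>n. t n \<noteq> t1) \<longrightarrow> converges_to_2cycle t p q)
        \<and> (t 0 \<in> {?f ?xm..?f (?f ?xm)} - {t1} \<longrightarrow> converges_to_2cycle t p q)"
      if xm: "t1 < ?xm" and U: "U p q" for p q
    proof -
      have cyc: "is_2cycle ?f p q" and pq: "p < t1" "t1 < q" "q \<le> ?xm"
        and uniq: "\<And>p' q'. is_2cycle ?f p' q' \<Longrightarrow> {p', q'} = {p, q}"
        using U unfolding U_def by blast+
      have f: "0 < p" "?f p = q" "?f q = p" using cyc by (auto simp: is_2cycle_def)
      have only: "x = q" if "t1 < x" "x < t2" "?f (?f x) = x" for x
      proof -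
        have "x \<in> {p, q}" using uniq is_cycle[OF that] by blast
        then show ?thesis using that pq by auto
      qed
      \<comment> \<open>f(f x) - x has no zero in (t1, q), so its sign is read off at
        \<open>q - h\<close>, just left of \<open>q\<close>, from the multiplier bound.\<close>
      have up: "x < ?f (?f x)" if x: "t1 < x" "x < q" for x
      proof -
        obtain e where e: "e > 0" "\<And>h. h > 0 \<Longrightarrow> h < e \<Longrightarrow> q - h < ?f (?f (q - h))"
          using two_cycle_attracts_from_left[OF f(1) _ pq(3) f(2,3)] pq by auto
        define h where "h = min (e / 2) ((q - t1) / 2)"
        have h: "h > 0" "h < e" "t1 < q - h" using e(1) pq by (auto simp: h_def min_def field_simps)
        have "?f (?f x) - x > 0"
        proof (rule isCont_same_sign[of t1 q "\<lambda>x. ?f (?f x) - x" "q - h" x])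
          show "isCont (\<lambda>x. ?f (?f x) - x) y" if "t1 < y" for y
            using isCont_ff[of y] that t1 by (intro continuous_intros) auto
          show "?f (?f y) - y \<noteq> 0" if "t1 < y" "y < q" for y
            using only[of y] that pq xm_t2 by auto
        qed (use e h x in auto)
        then show ?thesis by simp
      qed
      have z: "t1 \<le> q" "?f (?f q) = q" using pq f by auto
      have no: "?f (?f x) \<noteq> x" if "q < x" "x < t2" for x using only[of x] that pq by auto
      have swap: "converges_to_2cycle t q (?f q) \<Longrightarrow> converges_to_2cycle t p q"
        unfolding f(3) by (auto simp: converges_to_2cycle_def)
      have "converges_to_2cycle t q (?f q)" if "t 0 \<in> {\<delta><..<t2}" "\<forall>n. t n \<noteq> t1"
        by (rule cyc_conv(3)) (use that xm z pq no up in auto)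
      \<comment> \<open>This places the interval I inside [f xm, xm].\<close>
      moreover have "?f (?f ?xm) \<le> ?xm"
        by (rule cyc_conv(1)) (use xm z pq no up in auto)
      then have "converges_to_2cycle t q (?f q)"
        if "t 0 \<in> {?f ?xm..?f (?f ?xm)} - {t1}"
        by (intro cyc_conv(2)) (use that xm z pq no up in auto)
      ultimately show ?thesis using swap by blast
    qed
    show ?thesis
      using orbit_tendsto_t1_of_xm_le[OF sol pos T \<delta>(1) \<delta>_t2 \<delta>(3) le]
        orbit_outside_tendsto_t2[OF sol \<delta>(1) \<delta>_t2 \<delta>(3) le] a21 a22 by blast
  qed
  have S: "t 0 \<in> {s. s > 0 \<and> (\<exists>n. (?f ^^ n) s = t1)} \<longleftrightarrow> (\<exists>n. t n = t1)"
    using t(1) by (simp add: t_iter[symmetric])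
  have I: "(?f ^^ 2) ?xm = ?f (?f ?xm)" by (simp add: numeral_2_eq_2)
  show ?thesis
    unfolding Let_def Diff_iff S I U_def[symmetric]
  proof ((rule conjI; intro impI allI; elim conjE), goal_cases)
    case (1 \<delta>)
    note cases = part_a[OF 1, unfolded Diff_iff]
    show ?case
      using cases hit by blast
  next
    case (2 \<delta>)
    then show ?case by (rule part_b)
  qed
qed

end
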